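(* Let $G$ be a finite simple connected graph. Then both $h(G)$ and $\chi(G)$ are bounded above by $B(G)$, i.e. $h(G)\le B(G)$ and $\chi(G)\le B(G)$.
   Context: All graphs are finite and simple. The Hadwiger number $h(G)$ is the maximum $t$ such that the complete graph $K^{t}$ is a minor of $G$; $\chi(G)$ is the chromatic number. For a connected graph $G=(V,E)$, the first upper bound of $G$ is $$B(G)=\left\lfloor\frac{3+\sqrt{9+8(|E|-|V|)}}{2}\right\rfloor.$$ *)

theory Defs
  imports Complex_Main "Graph_Theory.Graph_Theory"
begin

text \<open>
  Finite simple graphs are the members of the locale \<^locale>\<open>graph\<close>: finite symmetric
  digraphs without loops and parallel arcs. There each undirected edge is represented by two
  opposite arcs, so \<open>|E|\<close> is the number of the following two-element vertex sets and not the
  number of arcs.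
\<close>

definition edges :: "('a, 'b) pre_digraph \<Rightarrow> 'a set set" where
  "edges G = (\<lambda>e. {tail G e, head G e}) ` arcs G"

text \<open>
  \<open>H\<close> is a minor of \<open>G\<close> if \<open>G\<close> has pairwise disjoint connected branch sets \<open>B x\<close>, one for each
  vertex \<open>x\<close> of \<open>H\<close>, with a \<open>G\<close>-edge between \<open>B x\<close> and \<open>B y\<close> for each edge \<open>xy\<close> of \<open>H\<close>.
  Connected graphs in the sense of \<^const>\<open>Digraph_Component.connected\<close> are nonempty, hence so
  are the branch sets. The qualifier avoids the topological constant of the same name.
\<close>

definition is_minor :: "('c, 'd) pre_digraph \<Rightarrow> ('a, 'b) pre_digraph \<Rightarrow> bool" where
  "is_minor H G \<longleftrightarrow> (\<exists>B :: 'c \<Rightarrow> 'a set.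
     (\<forall>x \<in> verts H. B x \<subseteq> verts G \<and> Digraph_Component.connected (G \<restriction> B x)) \<and>
     (\<forall>x \<in> verts H. \<forall>y \<in> verts H. x \<noteq> y \<longrightarrow> B x \<inter> B y = {}) \<and>
     (\<forall>(x, y) \<in> arcs_ends H. \<exists>u \<in> B x. \<exists>v \<in> B y. (u, v) \<in> arcs_ends G))"

definition complete_graph :: "nat \<Rightarrow> (nat, nat \<times> nat) pre_digraph" where
  "complete_graph t =
     with_proj \<lparr> pverts = {..<t}, parcs = {(i, j). i < t \<and> j < t \<and> i \<noteq> j} \<rparr>"

lemma complete_digraph_complete_graph: "K\<^bsub>t\<^esub> (complete_graph t)"
  unfolding complete_graph_def complete_digraph_pair_def by auto

definition hadwiger_number :: "('a, 'b) pre_digraph \<Rightarrow> nat" where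
  "hadwiger_number G = Max {t. is_minor (complete_graph t) G}"

definition proper_colouring :: "('a, 'b) pre_digraph \<Rightarrow> nat \<Rightarrow> ('a \<Rightarrow> nat) \<Rightarrow> bool" where
  "proper_colouring G k c \<longleftrightarrow>
     (\<forall>v \<in> verts G. c v < k) \<and> (\<forall>(u, v) \<in> arcs_ends G. c u \<noteq> c v)"

definition chromatic_number :: "('a, 'b) pre_digraph \<Rightarrow> nat" where
  "chromatic_number G = (LEAST k. \<exists>c. proper_colouring G k c)"

definition first_upper_bound :: "('a, 'b) pre_digraph \<Rightarrow> int" where
  "first_upper_bound G =
     \<lfloor>(3 + sqrt (9 + 8 * (real (card (edges G)) - real (card (verts G))))) / 2\<rfloor>"

text \<open>
  The maximum and the minimum above are taken over suitable sets, so neither of the two numbers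
  is an unspecified value.
\<close>

lemma complete_minor_le_card:
  assumes "finite (verts G)" and "is_minor (complete_graph t) G"
  shows "t \<le> card (verts G)"
proof -
  obtain B :: "nat \<Rightarrow> 'a set" where
    B: "\<forall>x \<in> {..<t}. B x \<subseteq> verts G \<and> Digraph_Component.connected (G \<restriction> B x)"
    and B': "\<forall>x \<in> {..<t}. \<forall>y \<in> {..<t}. x \<noteq> y \<longrightarrow> B x \<inter> B y = {}"
    using assms(2) unfolding is_minor_def complete_graph_def with_proj_simps pair_pre_digraph.simps
    by blast
  have sub: "B x \<subseteq> verts G" and con: "Digraph_Component.connected (G \<restriction> B x)" if "x < t" for x
    using B that by auto
  have dis: "B x \<inter> B y = {}" if "x < t" "y < t" "x \<noteq> y" for x y
    using B' that by auto
  have ne: "B x \<noteq> {}" if "x < t" for x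
    using con[OF that]
    by (auto simp: Digraph_Component.connected_def strongly_connected_def mk_symmetric_def)
  define f where "f x = (SOME v. v \<in> B x)" for x
  have f: "f x \<in> B x" if "x < t" for x
    unfolding f_def using ne[OF that] by (simp add: some_in_eq)
  have "inj_on f {..<t}"
    using f dis by (fastforce intro!: inj_onI)
  moreover have "f ` {..<t} \<subseteq> verts G"
    using f sub by blast
  ultimately show ?thesis
    using card_inj_on_le[of f "{..<t}" "verts G"] assms(1) by simp
qed

lemma hadwiger_set_finite:
  assumes "finite (verts G)"
  shows "finite {t. is_minor (complete_graph t) G}"
  by (rule finite_subset[of _ "{..card (verts G)}"])
    (use complete_minor_le_card[OF assms] in auto)

lemma hadwiger_set_nonempty: "is_minor (complete_graph 0) G"
  unfolding is_minor_def complete_graph_def by simp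

lemma (in graph) proper_colouring_exists: "\<exists>k c. proper_colouring G k c"
proof -
  obtain c where c: "bij_betw c (verts G) {0..<card (verts G)}"
    using ex_bij_betw_finite_nat[OF finite_verts] by blast
  have "c u \<noteq> c v" if "(u, v) \<in> arcs_ends G" for u v
    using that c adj_not_same[of u] adj_in_verts[of u v]
    by (auto simp: bij_betw_def inj_on_def)
  with c have "proper_colouring G (card (verts G)) c"
    unfolding proper_colouring_def by (auto simp: bij_betw_def)
  then show ?thesis by blast
qed

end

theory Submission
  imports Defs
begin

text \<open>
  Let \<open>n\<close> and \<open>m\<close> be the numbers of vertices and edges. For \<open>t \<ge> 3\<close>, \<open>t \<le> B(G)\<close> is
  equivalent to \<open>n + t (t - 3) / 2 \<le> m\<close>. In a connected graph, growing a nonempty vertex set \<open>U\<close>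
  one vertex at a time shows that at least \<open>|V - U|\<close> edges are not contained in \<open>U\<close>. So it
  suffices to find \<open>U\<close> inducing at least \<open>|U| + t (t - 3) / 2\<close> edges. For a \<open>K\<^sup>t\<close> minor take the union of
  the branch sets: each branch set \<open>B\<close> induces at least \<open>|B| - 1\<close> edges, and \<open>t (t - 1) / 2\<close>
  edges run between branch sets. For \<open>\<chi>(G) = t\<close> take a minimal \<open>U\<close> inducing a subgraph that is not
  \<open>(t - 1)\<close>-colourable: it has at least \<open>t\<close> vertices, each of degree at least \<open>t - 1\<close>.
\<close>

section \<open>Arithmetic of the first upper bound\<close>

text \<open>With \<open>d\<close> the radicand, the claim amounts to \<open>2 * t - 3\<close> \<le>
  \<open>sqrt d\<close>. The second hypothesis is this inequality squared and cleared of
  subtraction. For \<open>t\<close> at most 2 the first hypothesis suffices: it gives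
  \<open>d\<close> \<ge> 1.\<close>

lemma le_first_upper_bound:
  assumes "card (verts G) \<le> card (edges G) + 1"
    and "t \<ge> 3 \<Longrightarrow> t * t + 2 * card (verts G) \<le> 2 * card (edges G) + 3 * t"
  shows "int t \<le> first_upper_bound G"
proof -
  define d where "d = 9 + 8 * (real (card (edges G)) - real (card (verts G)))"
  have "real (card (verts G)) \<le> real (card (edges G)) + 1"
    using assms(1) by linarith
  then have d1: "1 \<le> d" unfolding d_def by (simp add: algebra_simps)
  have "2 * real t - 3 \<le> sqrt d"
  proof (cases "t \<ge> 3")
    case True
    have "real (t * t + 2 * card (verts G)) \<le> real (2 * card (edges G) + 3 * t)"
      using assms(2)[OF True] by (simp only: of_nat_le_iff)
    then have "(2 * real t - 3)\<^sup>2 \<le> d"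
      unfolding d_def power2_eq_square by (simp add: algebra_simps)
    then show ?thesis by (rule real_le_rsqrt)
  next
    case False
    then have "2 * real t - 3 \<le> 1" by linarith
    also have "1 \<le> sqrt d" using d1 by simp
    finally show ?thesis .
  qed
  then show ?thesis
    unfolding first_upper_bound_def d_def[symmetric] by (simp add: le_floor_iff)
qed

section \<open>Undirected edges and induced subgraphs\<close>

lemma edges_iff: "e \<in> edges G \<longleftrightarrow> (\<exists>u v. e = {u, v} \<and> (u, v) \<in> arcs_ends G)"
  unfolding edges_def arcs_ends_conv by auto

lemma edges_induce_subgraph: "edges (G \<restriction> U) = {e \<in> edges G. e \<subseteq> U}"
  unfolding edges_def by auto

lemma (in fin_digraph) finite_edges: "finite (edges G)"
  unfolding edges_def by simp

lemma (in wf_digraph) edge_subset_verts: "e \<in> edges G \<Longrightarrow> e \<subseteq> verts G"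
  unfolding edges_def by auto

lemma (in digraph) card_edge: "e \<in> edges G \<Longrightarrow> card e = 2"
  unfolding edges_def using no_loops by auto

lemma (in sym_digraph) edges_doubleton_iff: "{u, v} \<in> edges G \<longleftrightarrow> (u, v) \<in> arcs_ends G"
  unfolding edges_iff using arcs_ends_symmetric[OF sym_arcs] by (auto simp: doubleton_eq_iff)

section \<open>Counting edges in connected graphs\<close>

text \<open>If no edge left \<open>X\<close>, a walk starting in \<open>X\<close> could never reach
  a vertex outside.\<close>

lemma (in wf_digraph) connected_crossing_edge:
  assumes "Digraph_Component.connected G" and "X \<subset> verts G" and "X \<noteq> {}"
  shows "\<exists>u \<in> X. \<exists>w \<in> verts G - X. {u, w} \<in> edges G"
proof (rule ccontr)
  assume no: "\<not> ?thesis"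
  obtain x y where x: "x \<in> X" and y: "y \<in> verts G" "y \<notin> X" using assms(2,3) by blast
  interpret S: pair_wf_digraph "mk_symmetric G" by (rule wellformed_mk_symmetric)
  have "x \<rightarrow>\<^sup>*\<^bsub>mk_symmetric G\<^esub> y"
    using assms(1,2) x y unfolding Digraph_Component.connected_def strongly_connected_def by auto
  then have "y \<in> X"
  proof (induction rule: S.reachable_induct)
    case base
    show ?case by (rule x)
  next
    case (step u w)
    \<comment> \<open>An arc of \<open>mk_symmetric G\<close> may reverse an arc of
      \<open>G\<close>, so only its unordered pair of ends is recovered.\<close>
    from step(2) obtain e where e: "e \<in> arcs G" "{u, w} = {tail G e, head G e}"
      by (auto simp: parcs_mk_symmetric)
    then have "{u, w} \<in> edges G" unfolding edges_def by auto
    then show ?case using no step(3) edge_subset_verts by blast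
  qed
  with y show False by simp
qed

text \<open>Absorbing the outer end \<open>w\<close> of a crossing edge into \<open>U\<close> leaves
  one vertex fewer outside, and at least that edge no longer counts.\<close>

lemma (in fin_digraph) card_diff_le_edges_not_within:
  assumes "Digraph_Component.connected G" and "U \<subseteq> verts G" and "U \<noteq> {}"
  shows "card (verts G - U) \<le> card {e \<in> edges G. \<not> e \<subseteq> U}"
  using assms(2,3)
proof (induction "card (verts G - U)" arbitrary: U)
  case 0
  then show ?case by simp
next
  case (Suc k)
  then have "U \<noteq> verts G" by auto
  with Suc.prems obtain u w where uw: "u \<in> U" "w \<in> verts G - U" "{u, w} \<in> edges G"
    using connected_crossing_edge[OF assms(1), of U] by blast
  have "verts G - U = insert w (verts G - insert w U)" using uw by auto
  then have "card (verts G - U) = Suc (card (verts G - insert w U))"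
    by (metis Diff_iff card_insert_disjoint finite_Diff finite_verts insertI1)
  then have "k = card (verts G - insert w U)" using Suc.hyps(2) by simp
  then have "card (verts G - insert w U) \<le> card {e \<in> edges G. \<not> e \<subseteq> insert w U}"
    using Suc.hyps(1)[of "insert w U"] Suc.prems uw by auto
  also have "\<dots> < card {e \<in> edges G. \<not> e \<subseteq> U}"
  proof (rule psubset_card_mono)
    have "{u, w} \<notin> {e \<in> edges G. \<not> e \<subseteq> insert w U}" using uw(1) by simp
    moreover have "{u, w} \<in> {e \<in> edges G. \<not> e \<subseteq> U}" using uw(2,3) by simp
    ultimately show "{e \<in> edges G. \<not> e \<subseteq> insert w U} \<subset> {e \<in> edges G. \<not> e \<subseteq> U}" by blast
  qed (use finite_edges in simp)
  finally show ?case using \<open>card (verts G - U) = Suc _\<close> by simp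
qed

text \<open>The surplus of edges over vertices is at least as large in \<open>G\<close> as in any
  nonempty induced subgraph, so both bounds reduce to finding a dense \<open>U\<close>.\<close>

lemma (in fin_digraph) card_edges_ge_induced:
  assumes "Digraph_Component.connected G" and "U \<subseteq> verts G" and "U \<noteq> {}"
  shows "card (verts G) + card (edges (G \<restriction> U)) \<le> card (edges G) + card U"
proof -
  have "edges G = {e \<in> edges G. \<not> e \<subseteq> U} \<union> edges (G \<restriction> U)"
    by (auto simp: edges_induce_subgraph)
  moreover have "{e \<in> edges G. \<not> e \<subseteq> U} \<inter> edges (G \<restriction> U) = {}"
    by (auto simp: edges_induce_subgraph)
  ultimately have "card (edges G) = card {e \<in> edges G. \<not> e \<subseteq> U} + card (edges (G \<restriction> U))"
    by (metis card_Un_disjoint finite_Un finite_edges)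
  moreover have "card (verts G) = card (verts G - U) + card U"
    using assms(2) by (simp add: card_Diff_subset card_mono finite_subset[OF assms(2)])
  ultimately show ?thesis
    using card_diff_le_edges_not_within[OF assms] by simp
qed

text \<open>The case of a single vertex \<open>U = {r}\<close>. It is needed for \<open>G\<close>
  itself and for each branch set.\<close>

lemma (in fin_digraph) card_verts_le_card_edges:
  assumes "Digraph_Component.connected G"
  shows "card (verts G) \<le> card (edges G) + 1"
proof -
  obtain r where "r \<in> verts G"
    using assms by (auto simp: Digraph_Component.connected_def strongly_connected_def)
  then show ?thesis using card_edges_ge_induced[OF assms, of "{r}"] by simp
qed

section \<open>Complete minors\<close>

lemma complete_graph_ends:
  "verts (complete_graph t) = {..<t}"
  "(i, j) \<in> arcs_ends (complete_graph t) \<longleftrightarrow> i < t \<and> j < t \<and> i \<noteq> j"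
  unfolding complete_graph_def by auto

text \<open>The union \<open>U\<close> of the branch sets has at least \<open>card U - t\<close>
  edges inside branch sets and \<open>t choose 2\<close> between them. The condition on
  \<open>t\<close> makes \<open>U\<close> nonempty.\<close>

lemma (in fin_digraph) complete_minor_card_edges:
  assumes "Digraph_Component.connected G" and "is_minor (complete_graph t) G" and "t \<ge> 1"
  shows "(t choose 2) + card (verts G) \<le> card (edges G) + t"
proof -
  obtain B where B: "\<forall>i \<in> {..<t}. B i \<subseteq> verts G \<and> Digraph_Component.connected (G \<restriction> B i)"
    and B': "\<forall>i \<in> {..<t}. \<forall>j \<in> {..<t}. i \<noteq> j \<longrightarrow> B i \<inter> B j = {}"
    and B'': "\<forall>(i, j) \<in> arcs_ends (complete_graph t). \<exists>u \<in> B i. \<exists>v \<in> B j. (u, v) \<in> arcs_ends G"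
    using assms(2) unfolding is_minor_def complete_graph_ends(1) by blast
  have sub: "B i \<subseteq> verts G" and con: "Digraph_Component.connected (G \<restriction> B i)" if "i < t" for i
    using B that by auto
  have dis: "B i \<inter> B j = {}" if "i < t" "j < t" "i \<noteq> j" for i j
    using B' that by auto
  have adj: "\<exists>u \<in> B i. \<exists>v \<in> B j. (u, v) \<in> arcs_ends G" if "i < t" "j < t" "i \<noteq> j" for i j
    using bspec[OF B'', of "(i, j)"] that by (simp add: complete_graph_ends(2))
  have ne: "B i \<noteq> {}" if "i < t" for i
    using con[OF that] by (auto simp: Digraph_Component.connected_def strongly_connected_def)
  have finB: "finite (B i)" if "i < t" for i
    using sub[OF that] finite_verts by (rule finite_subset)
  have tree: "card (B i) \<le> card (edges (G \<restriction> B i)) + 1" if "i < t" for i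
  proof -
    interpret H: fin_digraph "G \<restriction> B i"
      using wellformed_induce_subgraph finB[OF that]
      by (intro wf_digraph.fin_digraphI) auto
    show ?thesis using H.card_verts_le_card_edges[OF con[OF that]] by simp
  qed
  define U where "U = (\<Union>i<t. B i)"
  \<comment> \<open>\<open>E\<close> collects the edges inside single branch sets; \<open>C\<close>
    is left with those joining two different ones.\<close>
  define E where "E = (\<Union>i<t. edges (G \<restriction> B i))"
  define C where "C = edges (G \<restriction> U) - E"
  have fin: "finite (edges (G \<restriction> X))" for X
    using finite_edges by (simp add: edges_induce_subgraph)
  have "card U = (\<Sum>i<t. card (B i))"
    unfolding U_def using finB dis by (intro card_UN_disjoint) auto
  also have "\<dots> \<le> (\<Sum>i<t. card (edges (G \<restriction> B i)) + 1)"
    using tree by (intro sum_mono) auto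
  also have "\<dots> = (\<Sum>i<t. card (edges (G \<restriction> B i))) + t"
    by (simp only: sum.distrib) simp
  also have "(\<Sum>i<t. card (edges (G \<restriction> B i))) = card E"
    unfolding E_def
  proof (rule card_UN_disjoint[symmetric])
    show "\<forall>i\<in>{..<t}. \<forall>j\<in>{..<t}. i \<noteq> j \<longrightarrow> edges (G \<restriction> B i) \<inter> edges (G \<restriction> B j) = {}"
    proof (intro ballI impI equals0I)
      fix i j e assume ij: "i \<in> {..<t}" "j \<in> {..<t}" "i \<noteq> j"
        and e: "e \<in> edges (G \<restriction> B i) \<inter> edges (G \<restriction> B j)"
      then have "e \<subseteq> B i \<inter> B j" by (auto simp: edges_induce_subgraph)
      also have "B i \<inter> B j = {}" using dis ij by simp
      finally show False using e by (auto simp: edges_def)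
    qed
  qed (use fin in auto)
  finally have E: "card U \<le> card E + t" .
  have C: "t choose 2 \<le> card C"
  proof -
    \<comment> \<open>\<open>g\<close> sends an edge to the indices of the branch sets it meets.
      Since every two-element index set arises from an edge in \<open>C\<close>, there are at least
      \<open>t choose 2\<close> such edges.\<close>
    define g where "g e = {i. i < t \<and> e \<inter> B i \<noteq> {}}" for e
    have "{s. s \<subseteq> {..<t} \<and> card s = 2} \<subseteq> g ` C"
    proof
      fix s assume "s \<in> {s. s \<subseteq> {..<t} \<and> card s = 2}"
      then obtain i j where s: "s = {i, j}" "i \<noteq> j" "i < t" "j < t"
        by (auto simp: card_2_iff)
      then obtain u v where uv: "u \<in> B i" "v \<in> B j" "(u, v) \<in> arcs_ends G" using adj by blast
      have only: "k = l" if "k < t" "l < t" "x \<in> B k" "x \<in> B l" for k l x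
        using dis that by blast
      have "g {u, v} = s" unfolding g_def using s uv only by blast
      moreover have "{u, v} \<in> C"
      proof -
        have "{u, v} \<in> edges G" using uv(3) edges_iff by blast
        moreover have "{u, v} \<subseteq> U" unfolding U_def using s uv by auto
        moreover have "\<not> {u, v} \<subseteq> B k" if "k < t" for k
          using only[of k i u] only[of k j v] that s uv by auto
        ultimately show ?thesis by (auto simp: C_def E_def edges_induce_subgraph)
      qed
      ultimately show "s \<in> g ` C" by blast
    qed
    then have "card {s. s \<subseteq> {..<t} \<and> card s = 2} \<le> card C"
      using fin unfolding C_def by (intro surj_card_le) auto
    then show ?thesis by (simp add: n_subsets)
  qed
  have "E \<subseteq> edges (G \<restriction> U)"
    unfolding E_def U_def edges_induce_subgraph by blast
  then have "card (edges (G \<restriction> U)) = card E + card C"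
    unfolding C_def using fin by (metis card_Diff_subset card_mono finite_subset le_add_diff_inverse)
  moreover have "card (verts G) + card (edges (G \<restriction> U)) \<le> card (edges G) + card U"
    using sub ne[of 0] \<open>t \<ge> 1\<close> by (intro card_edges_ge_induced[OF assms(1)]) (auto simp: U_def)
  ultimately show ?thesis using E C by simp
qed

section \<open>Colourings and minimum degree\<close>

text \<open>Double counting of incidences; an edge has exactly two ends because loops are
  excluded.\<close>

lemma (in digraph) handshake:
  assumes "U \<subseteq> verts G"
  shows "(\<Sum>v\<in>U. card {e \<in> edges (G \<restriction> U). v \<in> e}) = 2 * card (edges (G \<restriction> U))"
proof -
  have "finite U" using assms finite_verts by (rule finite_subset)
  moreover have "finite (edges (G \<restriction> U))"
    using finite_edges by (simp add: edges_induce_subgraph)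
  moreover have "card {v \<in> U. v \<in> e} = 2" if "e \<in> edges (G \<restriction> U)" for e
  proof -
    have "{v \<in> U. v \<in> e} = e" using that by (auto simp: edges_induce_subgraph)
    then show ?thesis using that card_edge by (simp add: edges_induce_subgraph)
  qed
  ultimately show ?thesis
    using sum_multicount[of U "edges (G \<restriction> U)" "\<lambda>v e. v \<in> e" 2] by (simp add: mult.commute)
qed

text \<open>Greedy step: the fewer than \<open>k\<close> edges at \<open>v\<close> block fewer than
  \<open>k\<close> colours, so some colour is free for \<open>v\<close>.\<close>

lemma (in graph) proper_colouring_extend:
  assumes v: "v \<in> U"
    and c: "proper_colouring (G \<restriction> (U - {v})) k c"
    and deg: "card {e \<in> edges (G \<restriction> U). v \<in> e} < k"
  shows "\<exists>c. proper_colouring (G \<restriction> U) k c"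
proof -
  define D where "D = {e \<in> edges (G \<restriction> U). v \<in> e}"
  have finD: "finite D" unfolding D_def edges_induce_subgraph using finite_edges by simp
  \<comment> \<open>For an edge \<open>e\<close> at \<open>v\<close>, \<open>e - {v}\<close> is a
    singleton, and \<open>h e\<close> is the colour of the other end.\<close>
  define h where "h e = c (the_elem (e - {v}))" for e
  have "card (h ` D) < card {..<k}"
    using card_image_le[OF finD, of h] deg unfolding D_def by simp
  then have "\<not> {..<k} \<subseteq> h ` D" using card_mono finD by (metis finite_imageI leD)
  then obtain a where a: "a < k" "a \<notin> h ` D" by auto
  have free: "c u \<noteq> a" if "u \<in> U" "(u, v) \<in> arcs_ends G" for u
  proof -
    have "u \<noteq> v" using that adj_not_same by blast
    then have "h {u, v} = c u" unfolding h_def by (simp add: insert_Diff_if)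
    moreover have "{u, v} \<in> D"
      using that v edges_doubleton_iff by (simp add: D_def edges_induce_subgraph)
    ultimately show ?thesis using a(2) by (metis imageI)
  qed
  have "proper_colouring (G \<restriction> U) k (c(v := a))"
    unfolding proper_colouring_def
  proof (intro conjI ballI; clarsimp split del: if_split)
    show "(if u = v then a else c u) < k" if "u \<in> U" for u
      using c a(1) that by (simp add: proper_colouring_def)
    fix x y assume xy: "x \<rightarrow>\<^bsub>G \<restriction> U\<^esub> y"
      and eq: "(if x = v then a else c x) = (if y = v then a else c y)"
    have xy': "x \<in> U" "y \<in> U" "(x, y) \<in> arcs_ends G" "(y, x) \<in> arcs_ends G"
      using xy arcs_ends_symmetric[OF sym_arcs] by (auto simp: arcs_ends_conv)
    then have "x \<noteq> y" using adj_not_same by blast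
    moreover have "c x \<noteq> c y" if "x \<noteq> v" "y \<noteq> v"
    proof -
      have "(x, y) \<in> arcs_ends (G \<restriction> (U - {v}))"
        using xy that by (auto simp: arcs_ends_conv)
      then show ?thesis using c by (auto simp: proper_colouring_def)
    qed
    ultimately show False using eq xy' free[of x] free[of y] by (auto split: if_splits)
  qed
  then show ?thesis by blast
qed

text \<open>Writing \<open>m'\<close> for the number of edges induced by the minimal
  \<open>U\<close>, the degree bound gives \<open>2 * m' - 2 * card U\<close> \<ge>
  \<open>card U * (k - 3)\<close> \<ge> \<open>k * (k - 3)\<close>; this surplus passes to
  \<open>G\<close>.\<close>

lemma (in graph) chromatic_number_card_edges:
  assumes "Digraph_Component.connected G" and k: "chromatic_number G = k" "k \<ge> 3"
  shows "k * k + 2 * card (verts G) \<le> 2 * card (edges G) + 3 * k"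
proof -
  define P where "P U \<longleftrightarrow> U \<subseteq> verts G \<and> (\<nexists>c. proper_colouring (G \<restriction> U) (k - 1) c)" for U
  have "\<nexists>c. proper_colouring G (k - 1) c"
    using not_less_Least[of "k - 1" "\<lambda>k. \<exists>c. proper_colouring G k c"] k
    unfolding chromatic_number_def by simp
  then have "P (verts G)"
    unfolding P_def proper_colouring_def by (auto simp: arcs_ends_conv)
  \<comment> \<open>Minimal cardinality makes \<open>U - {v}\<close> colourable with
    \<open>k - 1\<close> colours for each \<open>v\<close> in \<open>U\<close>, so a vertex of
    smaller degree would let the colouring extend to \<open>U\<close>.\<close>
  then obtain U where U: "P U" and min: "\<And>W. P W \<Longrightarrow> card U \<le> card W"
    using ex_has_least_nat[of P "verts G" card] by blast
  have sub: "U \<subseteq> verts G" and no: "\<nexists>c. proper_colouring (G \<restriction> U) (k - 1) c"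
    using U unfolding P_def by auto
  have finU: "finite U" using sub finite_verts by (rule finite_subset)
  have deg: "k - 1 \<le> card {e \<in> edges (G \<restriction> U). v \<in> e}" if v: "v \<in> U" for v
  proof (rule ccontr)
    assume "\<not> ?thesis"
    then have "\<nexists>c. proper_colouring (G \<restriction> (U - {v})) (k - 1) c"
      using proper_colouring_extend[OF v] no by (meson not_le)
    then have "P (U - {v})" unfolding P_def using sub by auto
    then show False using min card_Diff1_less[OF finU v] by (meson not_le)
  qed
  have cardU: "k \<le> card U"
  proof (rule ccontr)
    assume "\<not> ?thesis"
    then have "card U \<le> k - 1" by simp
    \<comment> \<open>With so few vertices, all of them can receive different colours.\<close>
    obtain c where c: "bij_betw c U {0..<card U}"
      using ex_bij_betw_finite_nat[OF finU] by blast
    have "c v < k - 1" if "v \<in> U" for v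
      using bij_betw_apply[OF c that] \<open>card U \<le> k - 1\<close> by simp
    moreover have "c x \<noteq> c y" if "(x, y) \<in> arcs_ends (G \<restriction> U)" for x y
    proof -
      have "x \<in> U" "y \<in> U" "x \<noteq> y" using that adj_not_same by (auto simp: arcs_ends_conv)
      then show ?thesis using c by (auto simp: bij_betw_def inj_on_def)
    qed
    ultimately have "proper_colouring (G \<restriction> U) (k - 1) c"
      unfolding proper_colouring_def by auto
    then show False using no by blast
  qed
  have "card U * (k - 1) \<le> (\<Sum>v\<in>U. card {e \<in> edges (G \<restriction> U). v \<in> e})"
    using sum_bounded_below[of U "k - 1" "\<lambda>v. card {e \<in> edges (G \<restriction> U). v \<in> e}"] deg by simp
  also have "\<dots> = 2 * card (edges (G \<restriction> U))" by (rule handshake[OF sub])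
  finally have h: "card U * (k - 1) \<le> 2 * card (edges (G \<restriction> U))" .
  have ge: "card (verts G) + card (edges (G \<restriction> U)) \<le> card (edges G) + card U"
    using cardU k(2) by (intro card_edges_ge_induced[OF assms(1) sub]) auto
  \<comment> \<open>The substitution removes truncated subtraction: \<open>l\<close> stands for
    \<open>k - 3\<close>.\<close>
  obtain l where l: "k = l + 3" using k(2) by (metis le_add_diff_inverse2)
  have "k * l \<le> card U * l" using cardU by simp
  with h ge show ?thesis unfolding l by (simp add: algebra_simps)
qed

section \<open>The bounds on the Hadwiger number and the chromatic number\<close>

theorem corollary2p2p2:
  fixes G :: "('a, 'b) pre_digraph"
  assumes "graph G"
    and "Digraph_Component.connected G"
  shows "int (hadwiger_number G) \<le> first_upper_bound G
       \<and> int (chromatic_number G) \<le> first_upper_bound G"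
proof
  interpret graph G by fact
  note tree = card_verts_le_card_edges[OF assms(2)]
  define t where "t = hadwiger_number G"
  \<comment> \<open>The maximum is attained, as the set of admissible \<open>t\<close> is finite and
    contains 0.\<close>
  have "is_minor (complete_graph t) G"
    using Max_in[OF hadwiger_set_finite[OF finite_verts]] hadwiger_set_nonempty
    unfolding t_def hadwiger_number_def by blast
  then have *: "(t choose 2) + card (verts G) \<le> card (edges G) + t" if "t \<ge> 3"
    using complete_minor_card_edges[OF assms(2)] that by simp
  \<comment> \<open>Doubling \<open>*\<close> and eliminating the binomial yields the quadratic
    hypothesis of \<open>le_first_upper_bound\<close>.\<close>
  have "2 * (t choose 2) = t * (t - 1)"
    unfolding choose_two by (rule dvd_mult_div_cancel) (cases t; simp)
  then have "2 * (t choose 2) + t = t * t" by (cases t) auto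
  then show "int (hadwiger_number G) \<le> first_upper_bound G"
    using * unfolding t_def[symmetric] by (intro le_first_upper_bound[OF tree]) linarith
  show "int (chromatic_number G) \<le> first_upper_bound G"
    by (intro le_first_upper_bound[OF tree] chromatic_number_card_edges[OF assms(2) refl])
qed

end
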